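(* There is a total type-3 functional $\xi$, Kleene-computable (S1–S9) in $\mathrm{IND}$ and $\exists^2$, such that whenever $(Y_n)_{n\in\mathbb{N}}$ is a sequence of open, dense sets of reals, $\xi(\lambda n.Y_n)\in\bigcap_{n\in\mathbb{N}}Y_n$.
   Context: Computability is Kleene's S1–S9. Reals are coded by fast-converging Cauchy sequences of rationals (elements of $\mathbb{N}^{\mathbb{N}}$). A set of reals is given by a function $Y:\mathbb{R}\to\mathbb{R}$, $x\in Y$ meaning $Y(x)>0$; $Y$ is open if for every $x\in Y$ there is a rational $r>0$ with $B(x,r)\subseteq Y$; dense means it meets every non-empty open interval. $\exists^2$ is the type-2 functional with $\exists^2(f)=0\leftrightarrow(\exists n)f(n)=0$ and $\exists^2(f)=1$ otherwise. $\mathrm{IND}$ is the type-3 inductive definition operator: for $F:2^{\mathbb{N}}\to2^{\mathbb{N}}$ (a map on subsets of $\mathbb{N}$), let $\Gamma(A)=A\cup F(A)$ and define by transfinite recursion $\Gamma_\alpha=\Gamma(\bigcup_{\beta<\alpha}\Gamma_\beta)$; there is an ordinal $\alpha_0$ with $\Gamma_{\alpha_0+1}=\Gamma_{\alpha_0}$, and $\mathrm{IND}(F)=\Gamma_{\alpha_0}$ (the inductive closure). *)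

theory Defs
  imports "HOL-Analysis.Analysis" "HOL-Library.Nat_Bijection"
begin

type_synonym baire = "nat \<Rightarrow> nat"
type_synonym type2 = "baire \<Rightarrow> nat"
type_synonym type3 = "type2 \<Rightarrow> nat"

text \<open>
  \<^prop>\<open>kleene e xs fs Fs Gs z\<close> means \<open>{e}(xs, fs, Fs, Gs) \<simeq> z\<close>, for arguments of the pure types
  0, 1, 2, 3 over the full set-theoretic type structure. As in Kleene's original presentation,
  only the order of the arguments within each type matters, hence one list per type. No arguments
  of type above 3 can arise in a computation whose arguments have type at most 3, so the
  restriction to these types loses nothing here. Indices are natural numbers via
  \<^const>\<open>list_encode\<close>; the argument signature is not recorded in the index.

  S6 moves the \<open>k\<close>-th type-\<open>j\<close> argument to the front. S8 applies the first argument of type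
  \<open>j = 2, 3\<close> to the function \<open>\<lambda>\<tau>. {h}(\<tau>, ...)\<close> with \<open>\<tau>\<close> of type \<open>j - 2\<close>, which is required to be
  total. S9 drops the index argument and all but an initial segment of the arguments of each type.
\<close>

definition move_front :: "nat \<Rightarrow> 'a list \<Rightarrow> 'a list" where
  "move_front k xs = xs ! k # take k xs @ drop (Suc k) xs"

inductive kleene ::
  "nat \<Rightarrow> nat list \<Rightarrow> baire list \<Rightarrow> type2 list \<Rightarrow> type3 list \<Rightarrow> nat \<Rightarrow> bool"
where
  S1: "kleene (list_encode [1]) (x # xs) fs Fs Gs (Suc x)"
| S2: "kleene (list_encode [2, q]) xs fs Fs Gs q"
| S3: "kleene (list_encode [3]) (x # xs) fs Fs Gs x"
| S4: "kleene h xs fs Fs Gs u \<Longrightarrow> kleene g (u # xs) fs Fs Gs z \<Longrightarrow>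
       kleene (list_encode [4, g, h]) xs fs Fs Gs z"
| S5_0: "kleene g xs fs Fs Gs z \<Longrightarrow>
       kleene (list_encode [5, g, h]) (0 # xs) fs Fs Gs z"
| S5_Suc: "kleene (list_encode [5, g, h]) (n # xs) fs Fs Gs u \<Longrightarrow>
       kleene h (n # u # xs) fs Fs Gs z \<Longrightarrow>
       kleene (list_encode [5, g, h]) (Suc n # xs) fs Fs Gs z"
| S6_0: "k < length xs \<Longrightarrow> kleene g (move_front k xs) fs Fs Gs z \<Longrightarrow>
       kleene (list_encode [6, 0, k, g]) xs fs Fs Gs z"
| S6_1: "k < length fs \<Longrightarrow> kleene g xs (move_front k fs) Fs Gs z \<Longrightarrow>
       kleene (list_encode [6, 1, k, g]) xs fs Fs Gs z"
| S6_2: "k < length Fs \<Longrightarrow> kleene g xs fs (move_front k Fs) Gs z \<Longrightarrow>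
       kleene (list_encode [6, 2, k, g]) xs fs Fs Gs z"
| S6_3: "k < length Gs \<Longrightarrow> kleene g xs fs Fs (move_front k Gs) z \<Longrightarrow>
       kleene (list_encode [6, 3, k, g]) xs fs Fs Gs z"
| S7: "kleene (list_encode [7]) (x # xs) (f # fs) Fs Gs (f x)"
| S8_2: "(\<And>n. kleene h (n # xs) fs (F # Fs) Gs (t n)) \<Longrightarrow>
       kleene (list_encode [8, 2, h]) xs fs (F # Fs) Gs (F t)"
| S8_3: "(\<And>f. kleene h xs (f # fs) Fs (G # Gs) (t f)) \<Longrightarrow>
       kleene (list_encode [8, 3, h]) xs fs Fs (G # Gs) (G t)"
| S9: "m0 \<le> length xs \<Longrightarrow> m1 \<le> length fs \<Longrightarrow> m2 \<le> length Fs \<Longrightarrow> m3 \<le> length Gs \<Longrightarrow>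
       kleene a (take m0 xs) (take m1 fs) (take m2 Fs) (take m3 Gs) z \<Longrightarrow>
       kleene (list_encode [9, m0, m1, m2, m3]) (a # xs) fs Fs Gs z"

lemma list_encode_conflict: "list_encode ks = list_encode ls \<Longrightarrow> ks \<noteq> ls \<Longrightarrow> P"
  by (simp add: list_encode_eq)

lemma kleene_S8_2_inv:
  "kleene e xs fs Fs Gs z \<Longrightarrow> e = list_encode [8, 2, h] \<Longrightarrow>
   \<exists>F Fs' t. Fs = F # Fs' \<and> z = F t \<and> (\<forall>n. kleene h (n # xs) fs Fs Gs (t n))"
  by (erule kleene.cases;
      ((drule (1) trans[OF sym], erule list_encode_conflict, simp (no_asm); fail)
       | (simp only: list_encode_eq list.inject, blast)))

lemma kleene_S8_3_inv:
  "kleene e xs fs Fs Gs z \<Longrightarrow> e = list_encode [8, 3, h] \<Longrightarrow>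
   \<exists>G Gs' t. Gs = G # Gs' \<and> z = G t \<and> (\<forall>f. kleene h xs (f # fs) Fs Gs (t f))"
  by (erule kleene.cases;
      ((drule (1) trans[OF sym], erule list_encode_conflict, simp (no_asm); fail)
       | (simp only: list_encode_eq list.inject, blast)))

lemma kleene_S8_2_unique:
  assumes "kleene (list_encode [8, 2, h]) xs fs (F # Fs) Gs z"
    and "\<And>n y. kleene h (n # xs) fs (F # Fs) Gs y \<Longrightarrow> t n = y"
  shows "F t = z"
proof -
  from kleene_S8_2_inv[OF assms(1) refl] obtain t'
    where t': "z = F t'" "\<And>n. kleene h (n # xs) fs (F # Fs) Gs (t' n)" by blast
  have "t = t'" by (intro ext assms(2) t'(2))
  then show ?thesis by (simp add: t'(1))
qed

lemma kleene_S8_3_unique: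
  assumes "kleene (list_encode [8, 3, h]) xs fs Fs (G # Gs) z"
    and "\<And>f y. kleene h xs (f # fs) Fs (G # Gs) y \<Longrightarrow> t f = y"
  shows "G t = z"
proof -
  from kleene_S8_3_inv[OF assms(1) refl] obtain t'
    where t': "z = G t'" "\<And>f. kleene h xs (f # fs) Fs (G # Gs) (t' f)" by blast
  have "t = t'" by (intro ext assms(2) t'(2))
  then show ?thesis by (simp add: t'(1))
qed

lemma kleene_unique:
  "kleene e xs fs Fs Gs y \<Longrightarrow> kleene e xs fs Fs Gs z \<Longrightarrow> y = z"
proof (induction arbitrary: z rule: kleene.induct)
  case S1
  from S1.prems show ?case
    by (rule kleene.cases) (simp_all add: list_encode_eq del: list_encode.simps)
next
  case S2
  from S2.prems show ?case
    by (rule kleene.cases) (simp_all add: list_encode_eq del: list_encode.simps)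
next
  case S3
  from S3.prems show ?case
    by (rule kleene.cases) (simp_all add: list_encode_eq del: list_encode.simps)
next
  case S7
  from S7.prems show ?case
    by (rule kleene.cases) (simp_all add: list_encode_eq del: list_encode.simps)
next
  case (S4 h xs fs Fs Gs u g y)
  from S4.prems obtain v where "kleene h xs fs Fs Gs v" "kleene g (v # xs) fs Fs Gs z"
    by (rule kleene.cases) (simp_all add: list_encode_eq del: list_encode.simps)
  then show ?case using S4.IH by metis
next
  case (S5_0 g xs fs Fs Gs y h)
  from S5_0.prems have "kleene g xs fs Fs Gs z"
    by (rule kleene.cases) (simp_all add: list_encode_eq del: list_encode.simps)
  then show ?case by (rule S5_0.IH)
next
  case (S5_Suc g h n xs fs Fs Gs u y)
  from S5_Suc.prems obtain v where
    "kleene (list_encode [5, g, h]) (n # xs) fs Fs Gs v" "kleene h (n # v # xs) fs Fs Gs z"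
    by (rule kleene.cases) (simp_all add: list_encode_eq del: list_encode.simps)
  then show ?case using S5_Suc.IH by metis
next
  case (S6_0 k xs g fs Fs Gs y)
  from S6_0.prems have "kleene g (move_front k xs) fs Fs Gs z"
    by (rule kleene.cases) (simp_all add: list_encode_eq del: list_encode.simps)
  then show ?case by (rule S6_0.IH)
next
  case (S6_1 k fs g xs Fs Gs y)
  from S6_1.prems have "kleene g xs (move_front k fs) Fs Gs z"
    by (rule kleene.cases) (simp_all add: list_encode_eq del: list_encode.simps)
  then show ?case by (rule S6_1.IH)
next
  case (S6_2 k Fs g xs fs Gs y)
  from S6_2.prems have "kleene g xs fs (move_front k Fs) Gs z"
    by (rule kleene.cases) (simp_all add: list_encode_eq del: list_encode.simps)
  then show ?case by (rule S6_2.IH)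
next
  case (S6_3 k Gs g xs fs Fs y)
  from S6_3.prems have "kleene g xs fs Fs (move_front k Gs) z"
    by (rule kleene.cases) (simp_all add: list_encode_eq del: list_encode.simps)
  then show ?case by (rule S6_3.IH)
next
  case (S9 m0 xs m1 fs m2 Fs m3 Gs a y)
  from S9.prems have "kleene a (take m0 xs) (take m1 fs) (take m2 Fs) (take m3 Gs) z"
    by (rule kleene.cases) (simp_all add: list_encode_eq del: list_encode.simps)
  then show ?case by (rule S9.IH)
qed (erule kleene_S8_2_unique kleene_S8_3_unique, blast)+

text \<open>
  A functional argument of type \<open>0 \<rightarrow> (1 \<rightarrow> 1)\<close> is presented as an object of pure type 2, by currying
  and the bijection between \<open>nat \<times> nat \<times> baire\<close> and \<open>baire\<close>.
\<close>

definition pure2 :: "(nat \<Rightarrow> baire \<Rightarrow> baire) \<Rightarrow> type2" where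
  "pure2 Y f = Y (f 0) (\<lambda>i. f (i + 2)) (f 1)"

lemma bij_pure2: "bij pure2"
proof (rule bijI)
  show "inj pure2"
  proof (rule injI)
    fix Y Z :: "nat \<Rightarrow> baire \<Rightarrow> baire"
    assume eq: "pure2 Y = pure2 Z"
    have "Y n f k = Z n f k" for n f k
      using fun_cong[OF eq, of "case_nat n (case_nat k f)"] by (simp add: pure2_def)
    then show "Y = Z" by (intro ext)
  qed
  show "surj pure2"
  proof (rule surjI)
    fix F :: type2
    show "pure2 (\<lambda>n f k. F (case_nat n (case_nat k f))) = F"
    proof
      fix f :: baire
      have "case_nat (f 0) (case_nat (f 1) (\<lambda>i. f (i + 2))) = f"
        by (rule ext) (simp split: nat.split)
      then show "pure2 (\<lambda>n f k. F (case_nat n (case_nat k f))) f = F f"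
        by (simp add: pure2_def)
    qed
  qed
qed

text \<open>
  \<open>\<xi>\<close> is total because its values on all arguments are given by convergent computations.
\<close>

definition kleene_computable_in ::
  "((nat \<Rightarrow> baire \<Rightarrow> baire) \<Rightarrow> baire) \<Rightarrow> type2 list \<Rightarrow> type3 list \<Rightarrow> bool" where
  "kleene_computable_in \<xi> Fs Gs \<longleftrightarrow>
     (\<exists>e. \<forall>Y k. kleene e [k] [] (pure2 Y # Fs) Gs (\<xi> Y k))"

definition E2 :: type2 where
  "E2 f = (if \<exists>n. f n = 0 then 0 else 1)"

text \<open>
  The ordinals below the first uncountable one suffice for iterating an inflationary operator on
  subsets of the natural numbers until it stabilises (\<open>Gamma_closes\<close> below).
\<close>

definition omega1 :: "nat set rel" where
  "omega1 = cardSuc natLeq"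

definition Gamma :: "(nat set \<Rightarrow> nat set) \<Rightarrow> nat set \<Rightarrow> nat set" where
  "Gamma F A = A \<union> F A"

definition Gamma_stage :: "(nat set \<Rightarrow> nat set) \<Rightarrow> nat set \<Rightarrow> nat set" where
  "Gamma_stage F = wo_rel.worec omega1 (\<lambda>s \<alpha>. Gamma F (\<Union>\<beta>\<in>underS omega1 \<alpha>. s \<beta>))"

definition IND :: "(nat set \<Rightarrow> nat set) \<Rightarrow> nat set" where
  "IND F = Gamma_stage F (SOME \<alpha>. \<alpha> \<in> Field omega1 \<and>
             Gamma_stage F (wo_rel.suc omega1 {\<alpha>}) = Gamma_stage F \<alpha>)"

lemma Card_order_omega1: "Card_order omega1"
  by (simp add: omega1_def cardSuc_Card_order natLeq_Card_order)

lemma wo_rel_omega1: "wo_rel omega1"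
  using Card_order_omega1 by (simp add: wo_rel_def card_order_on_def)

lemma Gamma_stage_eq:
  "Gamma_stage F \<alpha> = Gamma F (\<Union>\<beta>\<in>underS omega1 \<alpha>. Gamma_stage F \<beta>)"
proof -
  have "wo_rel.adm_wo omega1 (\<lambda>s \<alpha>. Gamma F (\<Union>\<beta>\<in>underS omega1 \<alpha>. s \<beta>))"
    unfolding wo_rel.adm_wo_def[OF wo_rel_omega1] by (metis SUP_cong)
  from wo_rel.worec_fixpoint[OF wo_rel_omega1 this]
  show ?thesis unfolding Gamma_stage_def by metis
qed

lemma Gamma_stage_mono: "\<beta> \<in> underS omega1 \<alpha> \<Longrightarrow> Gamma_stage F \<beta> \<subseteq> Gamma_stage F \<alpha>"
  by (subst (2) Gamma_stage_eq) (auto simp: Gamma_def)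

lemma Gamma_closes:
  includes cardinal_syntax
  shows "\<exists>\<alpha>\<in>Field omega1. Gamma_stage F (wo_rel.suc omega1 {\<alpha>}) = Gamma_stage F \<alpha>"
proof (rule ccontr)
  let ?s = "\<lambda>\<alpha>. wo_rel.suc omega1 {\<alpha>}"
  assume "\<not> ?thesis"
  then have neq: "Gamma_stage F (?s \<alpha>) \<noteq> Gamma_stage F \<alpha>" if "\<alpha> \<in> Field omega1" for \<alpha>
    using that by blast
  have inf: "infinite (Field omega1)"
    unfolding omega1_def cardSuc_finite[OF natLeq_Card_order] by (simp add: Field_natLeq)
  have ab: "AboveS omega1 {\<alpha>} \<noteq> {}" if "\<alpha> \<in> Field omega1" for \<alpha>
    using infinite_Card_order_limit[OF Card_order_omega1 inf that]
    by (auto simp: AboveS_def Field_def)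
  have suc: "\<alpha> \<in> underS omega1 (?s \<alpha>)" if "\<alpha> \<in> Field omega1" for \<alpha>
    using wo_rel.suc_greater[OF wo_rel_omega1 _ ab[OF that], of \<alpha>] that
    by (auto simp: underS_def)
  have le: "Gamma_stage F (?s \<alpha>) \<subseteq> Gamma_stage F \<beta>" if "\<alpha> \<in> underS omega1 \<beta>" for \<alpha> \<beta>
  proof -
    have "(?s \<alpha>, \<beta>) \<in> omega1"
      using that by (intro wo_rel.suc_least_AboveS[OF wo_rel_omega1])
        (auto simp: underS_def AboveS_def Field_def)
    then show ?thesis
      using Gamma_stage_mono[of "?s \<alpha>" \<beta> F] by (cases "?s \<alpha> = \<beta>") (auto simp: underS_def)
  qed
  have "\<exists>n. n \<in> Gamma_stage F (?s \<alpha>) - Gamma_stage F \<alpha>" if "\<alpha> \<in> Field omega1" for \<alpha>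
    using neq[OF that] Gamma_stage_mono[OF suc[OF that], of F] by blast
  then obtain p where p: "p \<alpha> \<in> Gamma_stage F (?s \<alpha>) - Gamma_stage F \<alpha>"
    if "\<alpha> \<in> Field omega1" for \<alpha> by metis
  have lt: "p \<alpha> \<noteq> p \<beta>"
    if "\<alpha> \<in> underS omega1 \<beta>" "\<alpha> \<in> Field omega1" "\<beta> \<in> Field omega1" for \<alpha> \<beta>
    using le[OF that(1)] p[OF that(2)] p[OF that(3)] by auto
  have "inj_on p (Field omega1)"
  proof (rule inj_onI, rule ccontr)
    fix \<alpha> \<beta>
    assume *: "\<alpha> \<in> Field omega1" "\<beta> \<in> Field omega1" "p \<alpha> = p \<beta>" "\<alpha> \<noteq> \<beta>"
    then have "(\<alpha>, \<beta>) \<in> omega1 \<or> (\<beta>, \<alpha>) \<in> omega1"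
      using wo_rel.TOTALS[OF wo_rel_omega1] by auto
    then have "\<alpha> \<in> underS omega1 \<beta> \<or> \<beta> \<in> underS omega1 \<alpha>"
      using *(4) by (auto simp: underS_def)
    then show False using lt[of \<alpha> \<beta>] lt[of \<beta> \<alpha>] * by auto
  qed
  then have "|Field omega1| \<le>o |UNIV :: nat set|"
    using card_of_ordLeq by blast
  moreover have "card_of (Field omega1) =o omega1"
    by (rule card_of_Field_ordIso[OF Card_order_omega1])
  ultimately have "omega1 \<le>o |UNIV :: nat set|"
    using ordIso_symmetric ordIso_ordLeq_trans by blast
  then have "omega1 \<le>o natLeq"
    using card_of_nat ordLeq_ordIso_trans by blast
  moreover have "natLeq <o omega1"
    unfolding omega1_def by (rule cardSuc_greater[OF natLeq_Card_order])
  ultimately show False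
    using not_ordLess_ordLeq by blast
qed

text \<open>
  \<open>IND1\<close> is \<^const>\<open>IND\<close> with sets replaced by characteristic functions, so that its type is
  \<open>(1 \<rightarrow> 1) \<rightarrow> 1\<close>. \<open>IND3\<close> is its version of pure type 3: the argument \<open>G\<close> codes both the operator,
  whose value at \<open>f\<close> and \<open>n\<close> is \<open>G\<close> at \<open>n + 1\<close> followed by \<open>f\<close>, and the number at which the resulting
  function is evaluated, which is \<open>G\<close> at the zero sequence.
\<close>

definition char_fun :: "nat set \<Rightarrow> baire" where
  "char_fun A n = (if n \<in> A then 1 else 0)"

definition IND1 :: "(baire \<Rightarrow> baire) \<Rightarrow> baire" where
  "IND1 \<Phi> = char_fun (IND (\<lambda>A. {n. \<Phi> (char_fun A) n > 0}))"

definition IND3 :: type3 where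
  "IND3 G = IND1 (\<lambda>f n. G (case_nat (Suc n) f)) (G (\<lambda>_. 0))"

lemma IND1_conv_IND3:
  "IND1 \<Phi> m = IND3 (\<lambda>g. case g 0 of 0 \<Rightarrow> m | Suc n \<Rightarrow> \<Phi> (\<lambda>i. g (Suc i)) n)"
  by (simp add: IND3_def)

definition codes_real :: "baire \<Rightarrow> real \<Rightarrow> bool" where
  "codes_real f x \<longleftrightarrow>
     (\<forall>n i. \<bar>nat_to_rat_surj (f n) - nat_to_rat_surj (f (n + i))\<bar> < 1 / 2 ^ n) \<and>
     (\<lambda>n. real_of_rat (nat_to_rat_surj (f n))) \<longlonglongrightarrow> x"

definition codes_real_fun :: "(baire \<Rightarrow> baire) \<Rightarrow> (real \<Rightarrow> real) \<Rightarrow> bool" where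
  "codes_real_fun \<Phi> Y \<longleftrightarrow> (\<forall>f x. codes_real f x \<longrightarrow> codes_real (\<Phi> f) (Y x))"

definition pos_set :: "(real \<Rightarrow> real) \<Rightarrow> real set" where
  "pos_set Y = {x. Y x > 0}"

definition dense_reals :: "real set \<Rightarrow> bool" where
  "dense_reals U \<longleftrightarrow> (\<forall>a b. a < b \<longrightarrow> U \<inter> {a<..<b} \<noteq> {})"

end

theory Submission
  imports Defs
begin

text \<open>
  Code the dyadic intervals in \<open>(1, 2)\<close> by natural numbers and let \<open>A\<close> be a set of codes \<open>(n, q)\<close>
  of guesses \<open>q \<subseteq> Y\<^sub>n\<close> that have been refuted. The intervals whose guess for \<open>n\<close> is not refuted
  include all those contained in \<open>Y\<^sub>n\<close>, so their union is open and dense in \<open>(1, 2)\<close>, and the usual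
  proof of the Baire category theorem, which is effective for such codes, yields intervals
  \<open>q\<^sub>0 \<supset> q\<^sub>1 \<supset> \<dots>\<close> shrinking to a point \<open>x\<close>, with \<open>(n, q\<^sub>n\<^sub>+\<^sub>1)\<close> not refuted. If \<open>x \<notin> Y\<^sub>n\<close>, then
  \<open>x\<close> itself refutes \<open>(n, q\<^sub>n\<^sub>+\<^sub>1)\<close>. Adding these pairs to \<open>A\<close> is an arithmetical operator; at its
  inductive closure nothing new can be added, so there \<open>x\<close> lies in every \<open>Y\<^sub>n\<close>.
\<close>

section \<open>Computability relative to the arguments\<close>

abbreviation kleene_in ::
  "(nat \<Rightarrow> baire \<Rightarrow> baire) \<Rightarrow> nat \<Rightarrow> nat list \<Rightarrow> baire list \<Rightarrow> nat \<Rightarrow> bool" where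
  "kleene_in Y e xs fs z \<equiv> kleene e xs fs [pure2 Y, E2] [IND3] z"

abbreviation proj_index :: "nat \<Rightarrow> nat" where
  "proj_index i \<equiv> list_encode [6, 0, i, list_encode [3]]"

section \<open>Projections, truncation and renaming of arguments\<close>

lemma kleene_proj:
  assumes "i < length xs"
  shows "kleene (proj_index i) xs fs Fs Gs (xs ! i)"
  using assms kleene.S3 by (intro kleene.S6_0) (simp_all add: move_front_def)

text \<open>S9 reads the index of the computation it calls from the first number; S4 with the
  constant \<open>e\<close> puts it there. The lengths stored in the new index discard
  \<open>ys\<close> and \<open>gs\<close>.\<close>

lemma kleene_truncate:
  assumes "kleene e xs fs Fs Gs z"
  shows "kleene (list_encode [4, list_encode [9, length xs, length fs, length Fs, length Gs],
           list_encode [2, e]]) (xs @ ys) (fs @ gs) Fs Gs z"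
  using assms by (intro kleene.S4[OF kleene.S2] kleene.S9) simp_all

text \<open>
  Stated for single computations rather than total functions, because unbounded search applies it
  to a call whose convergence is only known along the way.
\<close>

lemma kleene_rename:
  assumes "\<And>i. i < n \<Longrightarrow> \<sigma> i < n'" "m \<le> m'"
  shows "\<exists>e'. \<forall>xs fs Fs Gs z.
    length xs = n' \<and> length fs = m' \<and> length Fs = r \<and> length Gs = s \<and>
    kleene e (map (\<lambda>i. xs ! \<sigma> i) [0..<n]) (take m fs) Fs Gs z \<longrightarrow>
    kleene e' xs fs Fs Gs z" (is "\<exists>e'. \<forall>xs fs Fs Gs z. ?R xs fs Fs Gs z \<longrightarrow> _ e' xs fs Fs Gs z")
proof -
  \<comment> \<open>The selected numbers are pushed in front of \<open>xs\<close> one at a time, the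
    last one first. At \<open>k = 0\<close> all of them are there, and truncation leaves exactly the
    arguments of \<open>e\<close>.\<close>
  have "\<exists>e'. \<forall>xs fs Fs Gs z. ?R xs fs Fs Gs z \<longrightarrow>
    kleene e' (map (\<lambda>i. xs ! \<sigma> i) [k..<n] @ xs) fs Fs Gs z" if "k \<le> n" for k
    using that
  proof (induction k)
    case 0
    show ?case
    proof (intro exI allI impI)
      fix xs fs Fs Gs z
      assume R: "?R xs fs Fs Gs z"
      then show "kleene (list_encode [4, list_encode [9, n, m, r, s], list_encode [2, e]])
        (map (\<lambda>i. xs ! \<sigma> i) [0..<n] @ xs) fs Fs Gs z"
        using kleene_truncate[of e "map (\<lambda>i. xs ! \<sigma> i) [0..<n]" "take m fs" Fs Gs z xs "drop m fs"]
          assms(2) by simp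
    qed
  next
    case (Suc k)
    then obtain e' where e': "\<forall>xs fs Fs Gs z. ?R xs fs Fs Gs z \<longrightarrow>
        kleene e' (map (\<lambda>i. xs ! \<sigma> i) [k..<n] @ xs) fs Fs Gs z"
      by auto
    let ?p = "proj_index (n - Suc k + \<sigma> k)"
    show ?case
    proof (intro exI allI impI)
      fix xs fs Fs Gs z
      assume R: "?R xs fs Fs Gs z"
      let ?ys = "map (\<lambda>i. xs ! \<sigma> i) [Suc k..<n] @ xs"
      have nth: "?ys ! (n - Suc k + \<sigma> k) = xs ! \<sigma> k"
        by (simp add: nth_append)
      have p: "kleene ?p ?ys fs Fs Gs (xs ! \<sigma> k)"
        unfolding nth[symmetric] using assms(1)[of k] Suc.prems R by (intro kleene_proj) simp
      have "map (\<lambda>i. xs ! \<sigma> i) [k..<n] @ xs = xs ! \<sigma> k # ?ys"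
        using Suc.prems by (simp add: upt_conv_Cons)
      with e' R have "kleene e' (xs ! \<sigma> k # ?ys) fs Fs Gs z"
        by metis
      with p show "kleene (list_encode [4, e', ?p]) ?ys fs Fs Gs z"
        by (rule kleene.S4)
    qed
  qed
  from this[of n] show ?thesis by simp
qed

text \<open>
  The context consists of \<open>n\<close> numbers and \<open>m\<close> functions. No nested abstraction over functions is
  needed, so \<open>m\<close> is 0 or 1 and a single \<open>f\<close> suffices. The numbers are de Bruijn indices: rules that
  bind a variable put it in front as \<open>x 0\<close>.
\<close>

definition kcomp ::
  "nat \<Rightarrow> nat \<Rightarrow> ((nat \<Rightarrow> baire \<Rightarrow> baire) \<Rightarrow> (nat \<Rightarrow> nat) \<Rightarrow> baire \<Rightarrow> nat) \<Rightarrow> bool" where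
  "kcomp n m \<phi> \<longleftrightarrow>
     (\<exists>e. \<forall>Y x f. kleene_in Y e (map x [0..<n]) (replicate m f) (\<phi> Y x f))"

lemma kcompI:
  assumes "\<And>Y x f. kleene_in Y e (map x [0..<n]) (replicate m f) (\<phi> Y x f)"
  shows "kcomp n m \<phi>"
  using assms unfolding kcomp_def by blast

lemma kcompE:
  assumes "kcomp n m \<phi>"
  obtains e where "\<And>Y x f. kleene_in Y e (map x [0..<n]) (replicate m f) (\<phi> Y x f)"
  using assms unfolding kcomp_def by blast

lemma Cons_map_upt: "k # map x [0..<n] = map (case_nat k x) [0..<Suc n]"
  by (simp add: map_upt_Suc del: upt_Suc)

lemma kcomp_SucE:
  assumes "kcomp (Suc n) m (\<lambda>Y x f. b Y (\<lambda>i. x (Suc i)) f (x 0))"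
  obtains h where "\<And>Y x f k. kleene_in Y h (k # map x [0..<n]) (replicate m f) (b Y x f k)"
proof -
  from kcompE[OF assms] obtain h where h: "\<And>Y x f.
    kleene_in Y h (map x [0..<Suc n]) (replicate m f) (b Y (\<lambda>i. x (Suc i)) f (x 0))"
    by blast
  have "kleene_in Y h (k # map x [0..<n]) (replicate m f) (b Y x f k)" for Y x f k
    using h[where x = "case_nat k x"] unfolding Cons_map_upt[symmetric] by simp
  then show thesis by (rule that)
qed

text \<open>A computation sees only the first \<open>n\<close> numbers, and its value is
  unique.\<close>

lemma kcomp_cong:
  assumes "kcomp n m \<phi>" "\<And>i. i < n \<Longrightarrow> x i = y i"
  shows "\<phi> Y x f = \<phi> Y y f"
proof -
  from kcompE[OF assms(1)] obtain e where e: "\<And>Y x f.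
    kleene_in Y e (map x [0..<n]) (replicate m f) (\<phi> Y x f)"
    by blast
  have "map x [0..<n] = map y [0..<n]" using assms(2) by simp
  then show ?thesis using kleene_unique e by metis
qed

lemma kcomp_rename:
  assumes "kcomp n m \<phi>" "\<And>i. i < n \<Longrightarrow> \<sigma> i < n'" "m \<le> m'"
  shows "kcomp n' m' (\<lambda>Y x f. \<phi> Y (\<lambda>i. x (\<sigma> i)) f)"
proof -
  from kcompE[OF assms(1)] obtain e where e: "\<And>Y x f.
    kleene_in Y e (map x [0..<n]) (replicate m f) (\<phi> Y x f)"
    by blast
  from kleene_rename[where r = 2 and s = 1 and e = e, OF assms(2,3)]
  obtain e' where e': "\<forall>xs fs Fs Gs z.
    length xs = n' \<and> length fs = m' \<and> length Fs = 2 \<and> length Gs = 1 \<and>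
    kleene e (map (\<lambda>i. xs ! \<sigma> i) [0..<n]) (take m fs) Fs Gs z \<longrightarrow> kleene e' xs fs Fs Gs z"
    ..
  show ?thesis
  proof (rule kcompI)
    fix Y f and x :: "nat \<Rightarrow> nat"
    have "map (\<lambda>i. map x [0..<n'] ! \<sigma> i) [0..<n] = map (\<lambda>i. x (\<sigma> i)) [0..<n]"
      using assms(2) by auto
    then have "kleene_in Y e (map (\<lambda>i. map x [0..<n'] ! \<sigma> i) [0..<n]) (take m (replicate m' f))
        (\<phi> Y (\<lambda>i. x (\<sigma> i)) f)"
      using e[where x = "\<lambda>i. x (\<sigma> i)"] assms(3) by (simp only: take_replicate min_absorb1)
    then show "kleene_in Y e' (map x [0..<n']) (replicate m' f) (\<phi> Y (\<lambda>i. x (\<sigma> i)) f)"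
      by (intro e'[rule_format]) simp_all
  qed
qed

section \<open>Closure under Kleene's schemes and unbounded search\<close>

lemma kcomp_let:
  assumes "kcomp n m a" "kcomp (Suc n) m (\<lambda>Y x f. b Y (\<lambda>i. x (Suc i)) f (x 0))"
  shows "kcomp n m (\<lambda>Y x f. b Y x f (a Y x f))"
proof -
  from kcompE[OF assms(1)] obtain h where h: "\<And>Y x f.
    kleene_in Y h (map x [0..<n]) (replicate m f) (a Y x f)"
    by blast
  from kcomp_SucE[OF assms(2)] obtain g where g: "\<And>Y x f k.
    kleene_in Y g (k # map x [0..<n]) (replicate m f) (b Y x f k)"
    by blast
  show ?thesis
    by (rule kcompI, rule kleene.S4[OF h g])
qed

lemma kcomp_subst:
  assumes "kcomp n m \<phi>" "\<And>i. i < n \<Longrightarrow> kcomp n' m' (a i)" "m \<le> m'"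
  shows "kcomp n' m' (\<lambda>Y x f. \<phi> Y (\<lambda>i. a i Y x f) f)"
proof -
  \<comment> \<open>After \<open>k\<close> substitutions the context holds the \<open>n - k\<close>
    variables still to be replaced, followed by the \<open>n'\<close> new ones. Each step eliminates
    the front variable by \<open>kcomp_let\<close>.\<close>
  have "kcomp (n - k + n') m'
      (\<lambda>Y x f. \<phi> Y (\<lambda>i. if i < k then a i Y (\<lambda>j. x (j + (n - k))) f else x (i - k)) f)"
    if "k \<le> n" for k using that
  proof (induction k)
    case 0
    show ?case using kcomp_rename[OF assms(1) _ assms(3), of "\<lambda>i. i" "n + n'"] by simp
  next
    case (Suc k)
    let ?d = "n - Suc k"
    let ?b = "\<lambda>Y x f z. \<phi> Y (\<lambda>i. if i < k then a i Y (\<lambda>j. x (j + ?d)) f else case_nat z x (i - k)) f"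
    have a: "kcomp (?d + n') m' (\<lambda>Y x f. a k Y (\<lambda>j. x (j + ?d)) f)"
      using kcomp_rename[OF assms(2)[of k], of "\<lambda>j. j + ?d" "?d + n'"] Suc.prems by simp
    have d: "Suc (j + ?d) = j + (n - k)" "Suc (?d + n') = n - k + n'" for j
      using Suc.prems by auto
    have c: "case_nat (x 0) (\<lambda>i. x (Suc i)) = x" for x :: "nat \<Rightarrow> nat"
      by (auto split: nat.split)
    have "kcomp (Suc (?d + n')) m' (\<lambda>Y x f. ?b Y (\<lambda>i. x (Suc i)) f (x 0))"
      unfolding d c using Suc by simp
    from kcomp_let[where b = ?b, OF a this]
    show ?case
      by (rule back_subst[where P = "kcomp (?d + n') m'"])
        (auto intro!: ext arg_cong[where f = "\<lambda>z. \<phi> _ z _"] split: nat.split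
          simp: less_Suc_eq Suc_diff_le diff_Suc)
  qed
  from this[of n] have *: "kcomp n' m' (\<lambda>Y x f. \<phi> Y (\<lambda>i. if i < n then a i Y x f else x (i - n)) f)"
    by (simp cong: if_cong)
  have "(\<lambda>Y x f. \<phi> Y (\<lambda>i. if i < n then a i Y x f else x (i - n)) f)
      = (\<lambda>Y x f. \<phi> Y (\<lambda>i. a i Y x f) f)"
    by (intro ext kcomp_cong[OF assms(1)]) auto
  with * show ?thesis by simp
qed

lemma kcomp_var:
  assumes "i < n"
  shows "kcomp n m (\<lambda>Y x f. x i)"
proof (rule kcompI)
  fix Y f and x :: "nat \<Rightarrow> nat"
  show "kleene_in Y (proj_index i) (map x [0..<n]) (replicate m f) (x i)"
    using kleene_proj[of i "map x [0..<n]"] assms by simp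
qed

lemma kcomp_const: "kcomp n m (\<lambda>Y x f. c)"
  by (rule kcompI, rule kleene.S2)

lemma kcomp_Suc:
  assumes "kcomp n m t"
  shows "kcomp n m (\<lambda>Y x f. Suc (t Y x f))"
proof (rule kcomp_let[OF assms], rule kcompI)
  fix Y f and x :: "nat \<Rightarrow> nat"
  show "kleene_in Y (list_encode [1]) (map x [0..<Suc n]) (replicate m f) (Suc (x 0))"
    unfolding map_upt_Suc by (rule kleene.S1)
qed

lemma kcomp_app:
  assumes "kcomp n (Suc m) t"
  shows "kcomp n (Suc m) (\<lambda>Y x f. f (t Y x f))"
proof (rule kcomp_let[OF assms], rule kcompI)
  fix Y f and x :: "nat \<Rightarrow> nat"
  show "kleene_in Y (list_encode [7]) (map x [0..<Suc n]) (replicate (Suc m) f) (f (x 0))"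
    unfolding map_upt_Suc replicate_Suc by (rule kleene.S7)
qed

lemma kcomp_rec:
  assumes "kcomp n m a"
    "kcomp (Suc (Suc n)) m (\<lambda>Y x f. b Y (\<lambda>i. x (Suc (Suc i))) f (x 0) (x (Suc 0)))"
    "kcomp n m t"
  shows "kcomp n m (\<lambda>Y x f. rec_nat (a Y x f) (\<lambda>k u. b Y x f k u) (t Y x f))"
proof -
  from kcompE[OF assms(1)] obtain g where g: "\<And>Y x f.
    kleene_in Y g (map x [0..<n]) (replicate m f) (a Y x f)"
    by blast
  from kcompE[OF assms(2)] obtain h where h: "\<And>Y x f.
    kleene_in Y h (map x [0..<Suc (Suc n)]) (replicate m f)
      (b Y (\<lambda>i. x (Suc (Suc i))) f (x 0) (x (Suc 0)))"
    by blast
  \<comment> \<open>S5 recurses on the first number only; the general argument \<open>t\<close> is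
    put there afterwards by \<open>kcomp_let\<close>.\<close>
  have "kleene_in Y (list_encode [5, g, h]) (k # map x [0..<n]) (replicate m f)
    (rec_nat (a Y x f) (b Y x f) k)" for Y x f k
  proof (induction k)
    case 0
    show ?case using kleene.S5_0[OF g] by simp
  next
    case (Suc k)
    from h[where x = "case_nat k (case_nat _ x)"] kleene.S5_Suc[OF Suc] show ?case
      unfolding Cons_map_upt[symmetric] by (simp del: list_encode.simps)
  qed
  from this[where x = "\<lambda>i. _ (Suc i)"]
  have "kcomp (Suc n) m
      (\<lambda>Y x f. rec_nat (a Y (\<lambda>i. x (Suc i)) f) (b Y (\<lambda>i. x (Suc i)) f) (x 0))"
    by (intro kcompI) (simp only: map_upt_Suc)
  from kcomp_let[where b = "\<lambda>Y x f. rec_nat (a Y x f) (b Y x f)", OF assms(3) this]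
  show ?thesis .
qed

lemma kcomp_case:
  assumes "kcomp n m a" "kcomp (Suc n) m (\<lambda>Y x f. b Y (\<lambda>i. x (Suc i)) f (x 0))" "kcomp n m t"
  shows "kcomp n m (\<lambda>Y x f. case t Y x f of 0 \<Rightarrow> a Y x f | Suc k \<Rightarrow> b Y x f k)"
proof -
  have b: "kcomp (Suc (Suc n)) m (\<lambda>Y x f. b Y (\<lambda>i. x (Suc (Suc i))) f (x 0))"
    using kcomp_rename[OF assms(2), of "\<lambda>i. if i = 0 then 0 else Suc i" "Suc (Suc n)" m] by auto
  have *: "(case k of 0 \<Rightarrow> a | Suc k \<Rightarrow> b k) = rec_nat a (\<lambda>k u. b k) k"
    for a k :: nat and b :: "nat \<Rightarrow> nat"
    by (cases k) auto
  show ?thesis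
    unfolding * using assms b by (intro kcomp_rec)
qed

text \<open>Prefixes an entry to a computable sequence, with the bound variable as position; this
  assembles the coded argument of \<open>pure2 Y\<close>.\<close>

lemma kcomp_case_var:
  assumes "kcomp n m a" "kcomp (Suc n) m (\<lambda>Y x f. b Y (\<lambda>i. x (Suc i)) f (x 0))"
  shows "kcomp (Suc n) m
    (\<lambda>Y x f. case_nat (a Y (\<lambda>i. x (Suc i)) f) (b Y (\<lambda>i. x (Suc i)) f) (x 0))"
proof -
  have a: "kcomp (Suc n) m (\<lambda>Y x f. a Y (\<lambda>i. x (Suc i)) f)"
    using kcomp_rename[OF assms(1), of Suc "Suc n" m] by auto
  have b: "kcomp (Suc (Suc n)) m (\<lambda>Y x f. b Y (\<lambda>i. x (Suc (Suc i))) f (x 0))"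
    using kcomp_rename[OF assms(2), of "\<lambda>i. if i = 0 then 0 else Suc i" "Suc (Suc n)" m] by auto
  show ?thesis
    by (intro kcomp_case kcomp_var a b) simp
qed

lemma kcomp_E2:
  assumes "kcomp (Suc n) m (\<lambda>Y x f. b Y (\<lambda>i. x (Suc i)) f (x 0))"
  shows "kcomp n m (\<lambda>Y x f. E2 (\<lambda>k. b Y x f k))"
proof -
  from kcomp_SucE[OF assms] obtain h where h: "\<And>Y x f k.
    kleene_in Y h (k # map x [0..<n]) (replicate m f) (b Y x f k)"
    by blast
  \<comment> \<open>S8 applies the first type-2 argument, so \<open>E2\<close> is swapped to the
    front for the application, and \<open>pure2 Y\<close> is swapped back inside the
    abstraction.\<close>
  let ?h = "list_encode [6, 2, 1, h]"
  show ?thesis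
  proof (rule kcompI)
    fix Y f and x :: "nat \<Rightarrow> nat"
    from h have "kleene ?h (k # map x [0..<n]) (replicate m f) [E2, pure2 Y] [IND3] (b Y x f k)" for k
      by (intro kleene.S6_2) (simp_all add: move_front_def)
    then have "kleene (list_encode [8, 2, ?h]) (map x [0..<n]) (replicate m f) [E2, pure2 Y] [IND3]
        (E2 (b Y x f))"
      by (intro kleene.S8_2)
    then show "kleene_in Y (list_encode [6, 2, 1, list_encode [8, 2, ?h]])
        (map x [0..<n]) (replicate m f) (E2 (b Y x f))"
      by (intro kleene.S6_2) (simp_all add: move_front_def)
  qed
qed

lemma kcomp_Y:
  assumes "kcomp n m a" "kcomp (Suc n) m (\<lambda>Y x f. b Y (\<lambda>i. x (Suc i)) f (x 0))" "kcomp n m t"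
  shows "kcomp n m (\<lambda>Y x f. Y (a Y x f) (\<lambda>k. b Y x f k) (t Y x f))"
proof -
  \<comment> \<open>\<open>pure2\<close> expects the index of the sequence at position 0, the number
    of the final evaluation at position 1, and the function from position 2 on.\<close>
  let ?c = "\<lambda>Y x f. case_nat (a Y x f) (case_nat (t Y x f) (b Y x f))"
  have "kcomp (Suc n) m (\<lambda>Y x f. ?c Y (\<lambda>i. x (Suc i)) f (x 0))"
    by (intro kcomp_case_var assms)
  from kcomp_SucE[OF this] obtain h where h: "\<And>Y x f k.
    kleene_in Y h (k # map x [0..<n]) (replicate m f) (?c Y x f k)"
    by blast
  show ?thesis
  proof (rule kcompI)
    fix Y f and x :: "nat \<Rightarrow> nat"
    from h have "kleene_in Y (list_encode [8, 2, h]) (map x [0..<n]) (replicate m f)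
        (pure2 Y (?c Y x f))"
      by (intro kleene.S8_2)
    then show "kleene_in Y (list_encode [8, 2, h]) (map x [0..<n]) (replicate m f)
        (Y (a Y x f) (b Y x f) (t Y x f))"
      by (simp add: pure2_def del: list_encode.simps)
  qed
qed

lemma kcomp_IND3:
  assumes "kcomp n 1 (\<lambda>Y x f. b Y x f)"
  shows "kcomp n 0 (\<lambda>Y x f. IND3 (\<lambda>g. b Y x g))"
proof -
  from kcompE[OF assms] obtain h where h: "\<And>Y x f. kleene_in Y h (map x [0..<n]) [f] (b Y x f)"
    by auto
  show ?thesis
    by (rule kcompI, unfold replicate_0, rule kleene.S8_3, rule h)
qed

text \<open>
  Unbounded search. The index \<open>h\<close> receives itself as its first argument, so that S9 can call it
  again; the choice between returning and recursing is made on indices, since S5 would evaluate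
  both branches.
\<close>

lemma kcomp_LEAST:
  assumes P: "kcomp (Suc n) m (\<lambda>Y x f. if P Y (\<lambda>i. x (Suc i)) f (x 0) then 0 else 1)"
    and ex: "\<And>Y x f. \<exists>k. P Y x f k"
  shows "kcomp n m (\<lambda>Y x f. LEAST k. P Y x f k)"
proof -
  define call where "call = list_encode [9, Suc (Suc n), m, 2, 1]"
  have call: "kleene_in Y call (a # xs) (replicate m f) z"
    if "kleene_in Y a xs (replicate m f) z" "length xs = Suc (Suc n)" for a xs f Y z
    unfolding call_def by (rule kleene.S9) (simp_all add: that)
  \<comment> \<open>From \<open>Suc k # a # k # xs\<close> this selects
    \<open>a # a # Suc k # xs\<close>: one copy of \<open>a\<close> is the index that S9 calls, the
    other is handed on to that call, and \<open>Suc k\<close> takes the place of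
    \<open>k\<close>.\<close>
  define \<sigma> where "\<sigma> i = (if i \<le> 1 then 1 else if i = 2 then 0 else i)" for i :: nat
  have \<sigma>: "\<sigma> i < Suc (Suc (Suc n))" if "i < Suc (Suc (Suc n))" for i
    using that by (auto simp: \<sigma>_def)
  from kleene_rename[where \<sigma> = \<sigma> and r = 2 and s = 1 and e = call, OF \<sigma> order_refl]
  obtain recurse where recurse: "\<forall>xs fs Fs Gs z.
      length xs = Suc (Suc (Suc n)) \<and> length fs = m \<and> length Fs = 2 \<and> length Gs = 1 \<and>
      kleene call (map (\<lambda>i. xs ! \<sigma> i) [0..<Suc (Suc (Suc n))]) (take m fs) Fs Gs z \<longrightarrow>
      kleene recurse xs fs Fs Gs z"
    ..
  define succ where "succ = list_encode [4, list_encode [1], proj_index 1]"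
  define again where "again = list_encode [4, recurse, succ]"
  define stop where "stop = proj_index 1"
  have again: "kleene_in Y again (a # k # map x [0..<n]) (replicate m f) z"
    if "kleene_in Y a (a # Suc k # map x [0..<n]) (replicate m f) z" for Y x f a k z
  proof -
    have perm: "map (\<lambda>i. (Suc k # a # k # map x [0..<n]) ! \<sigma> i) [0..<Suc (Suc (Suc n))]
      = a # a # Suc k # map x [0..<n]"
      by (simp add: map_upt_Suc \<sigma>_def del: upt_Suc)
    have "kleene_in Y recurse (Suc k # a # k # map x [0..<n]) (replicate m f) z"
      by (intro recurse[rule_format], unfold perm) (simp add: call that)
    moreover have "kleene_in Y succ (a # k # map x [0..<n]) (replicate m f) (Suc k)"
      using kleene_proj[of 1 "a # k # map x [0..<n]"] unfolding succ_def
      by (intro kleene.S4[OF _ kleene.S1]) simp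
    ultimately show ?thesis unfolding again_def by (rule kleene.S4[rotated])
  qed
  have stop: "kleene_in Y stop (a # k # map x [0..<n]) (replicate m f) k" for Y x f a k
    using kleene_proj[of 1 "a # k # map x [0..<n]"] by (simp add: stop_def del: list_encode.simps)
  have "kcomp (Suc (Suc n)) m (\<lambda>Y x f. if P Y (\<lambda>i. x (Suc (Suc i))) f (x 1) then 0 else 1)"
    using kcomp_rename[OF P, of Suc "Suc (Suc n)" m] by simp
  then have "kcomp (Suc (Suc n)) m (\<lambda>Y x f.
      case (if P Y (\<lambda>i. x (Suc (Suc i))) f (x 1) then 0 else 1) of 0 \<Rightarrow> stop | Suc i \<Rightarrow> again)"
    by (intro kcomp_case kcomp_const)
  from kcompE[OF this] obtain c where
    c': "\<And>Y x f. kleene_in Y c (map x [0..<Suc (Suc n)]) (replicate m f)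
      (case (if P Y (\<lambda>i. x (Suc (Suc i))) f (x 1) then 0 else 1) of 0 \<Rightarrow> stop | Suc i \<Rightarrow> again)"
    by blast
  have c: "kleene_in Y c (a # k # map x [0..<n]) (replicate m f)
      (if P Y x f k then stop else again)" for Y x f a k
    using c'[of "case_nat a (case_nat k x)" f Y] unfolding Cons_map_upt[symmetric]
    by (simp split: if_splits)
  define h where "h = list_encode [4, call, c]"
  have h: "kleene_in Y h (a # k # map x [0..<n]) (replicate m f) z"
    if "kleene_in Y (if P Y x f k then stop else again) (a # k # map x [0..<n]) (replicate m f) z"
    for Y x f a k z
    unfolding h_def by (rule kleene.S4[OF c], rule call[OF that]) simp
  \<comment> \<open>Downward induction from the least witness: there \<open>stop\<close> returns
    \<open>k\<close>, and below it \<open>again\<close> passes to \<open>Suc k\<close>.\<close>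
  have search: "kleene_in Y h (h # k # map x [0..<n]) (replicate m f) (LEAST k. P Y x f k)"
    if "k \<le> (LEAST k. P Y x f k)" for Y x f k
    using that
  proof (induction k rule: inc_induct)
    case base
    show ?case
      using stop[of h "LEAST k. P Y x f k" x f Y] LeastI_ex[OF ex[of Y x f]] by (intro h) simp
  next
    case (step k)
    have "\<not> P Y x f k"
      using step.hyps not_less_Least[of k "P Y x f"] by simp
    then show ?case
      using again[OF step.IH] by (intro h) simp
  qed
  \<comment> \<open>The search is started by pushing 0 and then the index \<open>h\<close>
    itself.\<close>
  show ?thesis
    by (rule kcompI[where e = "list_encode [4, list_encode [4, h, list_encode [2, h]],
          list_encode [2, 0]]"])
      (rule kleene.S4[OF kleene.S2 kleene.S4[OF kleene.S2 search]], simp)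
qed

text \<open>A function parameter such as \<open>A\<close> in \<open>node\<close> occurs under
  further binders, where the context has grown; \<open>\<sigma>\<close> embeds the context of the
  parameter into the larger one.\<close>

lemma kcomp_param:
  assumes "kcomp (Suc n) m (\<lambda>Y x f. a Y (\<lambda>i. x (Suc i)) f (x 0))" "kcomp n' m' t"
    "\<And>i. i < n \<Longrightarrow> \<sigma> i < n'" "m \<le> m'"
  shows "kcomp n' m' (\<lambda>Y x f. a Y (\<lambda>i. x (\<sigma> i)) f (t Y x f))"
proof -
  have "kcomp n' m' (case i of 0 \<Rightarrow> t | Suc i \<Rightarrow> \<lambda>Y x f. x (\<sigma> i))" if "i < Suc n" for i
    using that assms(2,3) by (cases i) (auto intro: kcomp_var)
  from kcomp_subst[OF assms(1), of n' m' "case_nat t (\<lambda>i Y x f. x (\<sigma> i))", OF this assms(4)]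
  show ?thesis by simp
qed

section \<open>Arithmetic functions\<close>

lemma kcomp_unary:
  assumes "kcomp 1 0 (\<lambda>Y x f. F (x 0))" "kcomp n m a"
  shows "kcomp n m (\<lambda>Y x f. F (a Y x f))"
  using kcomp_subst[OF assms(1), of n m "\<lambda>_. a"] assms(2) by simp

lemma kcomp_binary:
  assumes "kcomp 2 0 (\<lambda>Y x f. F (x 0) (x 1))" "kcomp n m a" "kcomp n m b"
  shows "kcomp n m (\<lambda>Y x f. F (a Y x f) (b Y x f))"
  using kcomp_subst[OF assms(1), of n m "\<lambda>i. if i = 0 then a else b"] assms(2,3) by simp

lemma kcomp_add:
  assumes "kcomp n m a" "kcomp n m b"
  shows "kcomp n m (\<lambda>Y x f. a Y x f + b Y x f)"
proof (rule kcomp_binary[OF _ assms])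
  have *: "a + b = rec_nat a (\<lambda>_. Suc) b" for a b :: nat by (induction b) auto
  show "kcomp 2 0 (\<lambda>Y x f. x 0 + x 1)"
    unfolding * by (intro kcomp_rec kcomp_Suc kcomp_var) auto
qed

lemma kcomp_mult:
  assumes "kcomp n m a" "kcomp n m b"
  shows "kcomp n m (\<lambda>Y x f. a Y x f * b Y x f)"
proof (rule kcomp_binary[OF _ assms])
  have *: "a * b = rec_nat 0 (\<lambda>_ u. a + u) b" for a b :: nat by (induction b) auto
  show "kcomp 2 0 (\<lambda>Y x f. x 0 * x 1)"
    unfolding * by (intro kcomp_rec kcomp_add kcomp_const kcomp_var) auto
qed

lemma kcomp_power:
  assumes "kcomp n m a" "kcomp n m b"
  shows "kcomp n m (\<lambda>Y x f. a Y x f ^ b Y x f)"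
proof (rule kcomp_binary[OF _ assms])
  have *: "a ^ b = rec_nat 1 (\<lambda>_ u. a * u) b" for a b :: nat by (induction b) auto
  show "kcomp 2 0 (\<lambda>Y x f. x 0 ^ x 1)"
    unfolding * by (intro kcomp_rec kcomp_mult kcomp_const kcomp_var) auto
qed

lemma kcomp_diff:
  assumes "kcomp n m a" "kcomp n m b"
  shows "kcomp n m (\<lambda>Y x f. a Y x f - b Y x f)"
proof (rule kcomp_binary[OF _ assms])
  have *: "a - b = rec_nat a (\<lambda>_ u. case u of 0 \<Rightarrow> 0 | Suc v \<Rightarrow> v) b" for a b :: nat
    by (induction b) (auto simp: diff_Suc)
  show "kcomp 2 0 (\<lambda>Y x f. x 0 - x 1)"
    unfolding * by (intro kcomp_rec kcomp_case kcomp_const kcomp_var) auto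
qed

lemma kcomp_prod_encode:
  assumes "kcomp n m a" "kcomp n m b"
  shows "kcomp n m (\<lambda>Y x f. prod_encode (a Y x f, b Y x f))"
proof -
  have *: "triangle k = rec_nat 0 (\<lambda>k u. u + Suc k) k" for k by (induction k) auto
  have "kcomp 1 0 (\<lambda>Y x f. triangle (x 0))"
    unfolding * by (intro kcomp_rec kcomp_add kcomp_Suc kcomp_const kcomp_var) auto
  from kcomp_unary[OF this kcomp_add[OF assms]] show ?thesis
    unfolding prod_encode_def prod.case by (intro kcomp_add assms(1))
qed

section \<open>Predicates with computable characteristic functions\<close>

text \<open>
  Truth is 0, so that E2 computes the existential quantifier.
\<close>

definition kpred ::
  "nat \<Rightarrow> nat \<Rightarrow> ((nat \<Rightarrow> baire \<Rightarrow> baire) \<Rightarrow> (nat \<Rightarrow> nat) \<Rightarrow> baire \<Rightarrow> bool) \<Rightarrow> bool" where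
  "kpred n m P \<longleftrightarrow> kcomp n m (\<lambda>Y x f. if P Y x f then 0 else 1)"

lemma kpred_rename:
  assumes "kpred n m P" "\<And>i. i < n \<Longrightarrow> \<sigma> i < n'" "m \<le> m'"
  shows "kpred n' m' (\<lambda>Y x f. P Y (\<lambda>i. x (\<sigma> i)) f)"
  using kcomp_rename[OF assms(1)[unfolded kpred_def] assms(2,3)] by (simp add: kpred_def)

text \<open>S5 may evaluate both branches, which is harmless because everything in
  \<open>kcomp\<close> is total.\<close>

lemma kcomp_if:
  assumes "kpred n m P" "kcomp n m a" "kcomp n m b"
  shows "kcomp n m (\<lambda>Y x f. if P Y x f then a Y x f else b Y x f)"
proof -
  have "kcomp (Suc n) m (\<lambda>Y x f. b Y (\<lambda>i. x (Suc i)) f)"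
    using kcomp_rename[OF assms(3), of Suc "Suc n" m] by simp
  then have "kcomp n m (\<lambda>Y x f. case (if P Y x f then 0 else 1) of 0 \<Rightarrow> a Y x f | Suc _ \<Rightarrow> b Y x f)"
    using assms(1,2) unfolding kpred_def by (intro kcomp_case)
  moreover have "(case (if p then 0 else 1) of 0 \<Rightarrow> a | Suc _ \<Rightarrow> b) = (if p then a else b)"
    for p and a b :: nat
    by simp
  ultimately show ?thesis by (simp only:)
qed

lemma kpred_not:
  assumes "kpred n m P"
  shows "kpred n m (\<lambda>Y x f. \<not> P Y x f)"
proof -
  have *: "(if \<not> p then 0 else 1) = (if p then 1 else 0::nat)" for p by simp
  show ?thesis unfolding kpred_def * by (intro kcomp_if kcomp_const assms)
qed

lemma kpred_conj:
  assumes "kpred n m P" "kpred n m Q"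
  shows "kpred n m (\<lambda>Y x f. P Y x f \<and> Q Y x f)"
proof -
  have *: "(if p \<and> q then 0 else 1) = (if p then if q then 0 else 1 else 1::nat)" for p q by simp
  show ?thesis unfolding kpred_def * by (intro kcomp_if kcomp_const assms)
qed

lemma kpred_disj:
  assumes "kpred n m P" "kpred n m Q"
  shows "kpred n m (\<lambda>Y x f. P Y x f \<or> Q Y x f)"
proof -
  have *: "(if p \<or> q then 0 else 1) = (if p then 0 else if q then 0 else 1::nat)" for p q by simp
  show ?thesis unfolding kpred_def * by (intro kcomp_if kcomp_const assms)
qed

lemma kpred_ex:
  assumes "kpred (Suc n) m (\<lambda>Y x f. P Y (\<lambda>i. x (Suc i)) f (x 0))"
  shows "kpred n m (\<lambda>Y x f. \<exists>k. P Y x f k)"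
proof -
  have *: "(if \<exists>k. p k then 0 else 1) = E2 (\<lambda>k. if p k then 0 else 1)" for p by (simp add: E2_def)
  show ?thesis unfolding kpred_def * by (intro kcomp_E2 assms[unfolded kpred_def])
qed

lemma kpred_le:
  assumes "kcomp n m a" "kcomp n m b"
  shows "kpred n m (\<lambda>Y x f. a Y x f \<le> b Y x f)"
proof -
  have *: "(if a \<le> b then 0 else 1::nat) = (case a - b of 0 \<Rightarrow> 0 | Suc _ \<Rightarrow> 1)" for a b :: nat
    by (auto split: nat.split)
  show ?thesis unfolding kpred_def * by (intro kcomp_case kcomp_diff kcomp_const assms)
qed

lemma kpred_less:
  assumes "kcomp n m a" "kcomp n m b"
  shows "kpred n m (\<lambda>Y x f. a Y x f < b Y x f)"
  unfolding less_eq_Suc_le by (intro kpred_le kcomp_Suc assms)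

lemma kpred_eq:
  assumes "kcomp n m a" "kcomp n m b"
  shows "kpred n m (\<lambda>Y x f. a Y x f = b Y x f)"
  unfolding order.eq_iff by (intro kpred_conj kpred_le assms)

text \<open>
  The second disjunct makes the search succeed always; \<open>mu P = 0\<close> if nothing satisfies \<open>P\<close>.
\<close>

definition mu :: "(nat \<Rightarrow> bool) \<Rightarrow> nat" where
  "mu P = (LEAST k. P k \<or> \<not> (\<exists>k. P k))"

lemma mu: "P k \<Longrightarrow> P (mu P)"
  unfolding mu_def by (metis (mono_tags, lifting) LeastI)

text \<open>The existence clause in \<open>mu\<close> is decided by \<open>E2\<close>; it makes the
  search succeed for all arguments, as \<open>kcomp_LEAST\<close> demands.\<close>

lemma kcomp_mu:
  assumes "kpred (Suc n) m (\<lambda>Y x f. P Y (\<lambda>i. x (Suc i)) f (x 0))"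
  shows "kcomp n m (\<lambda>Y x f. mu (\<lambda>k. P Y x f k))"
proof -
  have "kpred (Suc (Suc n)) m (\<lambda>Y x f. P Y (\<lambda>i. x (Suc (Suc i))) f (x 0))"
    using kpred_rename[OF assms, of "\<lambda>i. if i = 0 then 0 else Suc i" "Suc (Suc n)" m] by auto
  then have "kpred (Suc n) m
      (\<lambda>Y x f. P Y (\<lambda>i. x (Suc i)) f (x 0) \<or> \<not> (\<exists>k. P Y (\<lambda>i. x (Suc i)) f k))"
    by (intro kpred_disj kpred_not kpred_ex assms)
  then show ?thesis
    unfolding mu_def kpred_def by (rule kcomp_LEAST) blast
qed

lemmas kcomp_intros = kcomp_const kcomp_var kcomp_Suc kcomp_app kcomp_add kcomp_mult kcomp_power
  kcomp_prod_encode kcomp_if kcomp_mu kcomp_rec kcomp_Y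
  kpred_not kpred_conj kpred_disj kpred_ex kpred_less kpred_eq

section \<open>The point determined by a set of refuted guesses\<close>

text \<open>
  The number \<open>p \<ge> 1\<close> codes the interval \<open>(p / 2^k, (p + 1) / 2^k)\<close> where \<open>2^k \<le> p < 2^(k + 1)\<close>, and
  \<open>subnode p q\<close> says that the closure of the interval \<open>q\<close> lies in the interval \<open>p\<close>. The rational
  numbers \<open>a / b\<close> and \<open>(- a - 1) / (- b - 1)\<close> have the codes \<open>(2 a, 2 b)\<close> and \<open>(2 a + 1, 2 b + 1)\<close>,
  whence \<open>point\<close> and \<open>pos_rat\<close>, which means that \<open>v\<close> codes a number greater than \<open>1 / 2^k\<close>.
\<close>

definition lg :: "nat \<Rightarrow> nat" where
  "lg p = mu (\<lambda>k. p < 2 ^ Suc k)"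

definition subnode :: "nat \<Rightarrow> nat \<Rightarrow> bool" where
  "subnode p q \<longleftrightarrow> (\<exists>i r. q = p * 2 ^ i + r \<and> 0 < r \<and> Suc r < 2 ^ i)"

text \<open>The root 1 codes the interval from 1 to 2. If no subnode is left unrefuted,
  \<open>mu\<close> gives 0, which keeps \<open>node\<close> total for arbitrary
  \<open>A\<close>.\<close>

definition node :: "baire \<Rightarrow> baire" where
  "node A n = rec_nat 1 (\<lambda>n p. mu (\<lambda>q. subnode p q \<and> A (prod_encode (n, q)) = 0)) n"

definition point :: "baire \<Rightarrow> baire" where
  "point A n = prod_encode (2 * node A n, 2 * 2 ^ lg (node A n))"

definition pos_rat :: "nat \<Rightarrow> nat \<Rightarrow> bool" where
  "pos_rat v k \<longleftrightarrow> (\<exists>a b. v = prod_encode (2 * a, 2 * b) \<and> 0 < b \<and> b < a * 2 ^ k \<or>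
     v = prod_encode (2 * a + 1, 2 * b + 1) \<and> b + 1 < (a + 1) * 2 ^ k)"

text \<open>As \<open>node A 0\<close> is the root, the guess about the \<open>n\<close>-th set is
  \<open>node A (Suc n)\<close>. The inner existential expresses that the real coded by
  \<open>Y n (point A)\<close> is positive.\<close>

definition refutations :: "(nat \<Rightarrow> baire \<Rightarrow> baire) \<Rightarrow> baire \<Rightarrow> baire" where
  "refutations Y A m =
     (if \<exists>n. m = prod_encode (n, node A (Suc n)) \<and> \<not> (\<exists>k. pos_rat (Y n (point A) k) k)
      then 1 else 0)"

section \<open>Computability of the point\<close>

lemma kcomp_lg:
  assumes "kcomp n m a"
  shows "kcomp n m (\<lambda>Y x f. lg (a Y x f))"
proof (rule kcomp_unary[OF _ assms])
  show "kcomp 1 0 (\<lambda>Y x f. lg (x 0))"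
    unfolding lg_def by (intro kcomp_intros) auto
qed

lemma kpred_subnode:
  assumes "kcomp n m a" "kcomp n m b"
  shows "kpred n m (\<lambda>Y x f. subnode (a Y x f) (b Y x f))"
  unfolding kpred_def
proof (rule kcomp_binary[OF _ assms], fold kpred_def)
  show "kpred 2 0 (\<lambda>Y x f. subnode (x 0) (x 1))"
    unfolding subnode_def by (intro kcomp_intros) auto
qed

lemma kpred_pos_rat:
  assumes "kcomp n m a" "kcomp n m b"
  shows "kpred n m (\<lambda>Y x f. pos_rat (a Y x f) (b Y x f))"
  unfolding kpred_def
proof (rule kcomp_binary[OF _ assms], fold kpred_def)
  show "kpred 2 0 (\<lambda>Y x f. pos_rat (x 0) (x 1))"
    unfolding pos_rat_def by (intro kcomp_intros) auto
qed

lemma kcomp_node: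
  assumes "kcomp (Suc n) m (\<lambda>Y x f. A Y (\<lambda>i. x (Suc i)) f (x 0))" "kcomp n m t"
  shows "kcomp n m (\<lambda>Y x f. node (\<lambda>j. A Y x f j) (t Y x f))"
  unfolding node_def by (intro kcomp_intros kpred_subnode kcomp_param[OF assms(1)] assms(2)) auto

lemma kcomp_point:
  assumes "kcomp (Suc n) m (\<lambda>Y x f. A Y (\<lambda>i. x (Suc i)) f (x 0))" "kcomp n m t"
  shows "kcomp n m (\<lambda>Y x f. point (\<lambda>j. A Y x f j) (t Y x f))"
  unfolding point_def by (intro kcomp_intros kcomp_node kcomp_lg assms)

lemma kcomp_refutations:
  assumes "kcomp (Suc n) m (\<lambda>Y x f. A Y (\<lambda>i. x (Suc i)) f (x 0))" "kcomp n m t"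
  shows "kcomp n m (\<lambda>Y x f. refutations Y (\<lambda>j. A Y x f j) (t Y x f))"
proof -
  note t = kcomp_rename[OF assms(2), of "\<lambda>i. Suc i" "Suc n" m]
  show ?thesis
    unfolding refutations_def
    by (intro kcomp_intros kcomp_node kcomp_point kpred_pos_rat kcomp_param[OF assms(1)] t) auto
qed

lemma kcomp_IND1_refutations:
  assumes "kcomp n 0 t"
  shows "kcomp n 0 (\<lambda>Y x f. IND1 (refutations Y) (t Y x f))"
proof -
  \<comment> \<open>With no function in the context \<open>t\<close> cannot depend on
    \<open>f\<close>, so the zero sequence may stand for it. This frees the function variable for
    the argument bound by \<open>IND3\<close>.\<close>
  define s where "s Y x = t Y x (\<lambda>_. 0)" for Y x
  have t: "t = (\<lambda>Y x f. s Y x)"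
    using assms unfolding kcomp_def replicate_0 s_def by (intro ext) (metis kleene_unique)
  have s: "kcomp n (Suc 0) (\<lambda>Y x f. s Y x)"
    using kcomp_rename[OF assms, of "\<lambda>i. i" n "Suc 0"] unfolding t by simp
  show ?thesis
    unfolding t IND1_conv_IND3
    by (intro kcomp_IND3, unfold One_nat_def) (intro kcomp_case kcomp_refutations kcomp_intros s, auto)
qed

definition baire_point :: "(nat \<Rightarrow> baire \<Rightarrow> baire) \<Rightarrow> baire" where
  "baire_point Y = point (IND1 (refutations Y))"

lemma kleene_computable_baire_point: "kleene_computable_in baire_point [E2] [IND3]"
proof -
  have "kcomp 1 0 (\<lambda>Y x f. baire_point Y (x 0))"
    unfolding baire_point_def by (intro kcomp_point kcomp_IND1_refutations kcomp_var) auto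
  from kcompE[OF this] obtain e where e: "\<And>Y x f.
    kleene_in Y e (map x [0..<1]) (replicate 0 f) (baire_point Y (x 0))"
    by blast
  have "kleene_in Y e [k] [] (baire_point Y k)" for Y k
    using e[where x = "\<lambda>_. k"] by simp
  then show ?thesis
    unfolding kleene_computable_in_def by blast
qed

section \<open>Inductive closure\<close>

text \<open>At a stabilising \<open>\<alpha>\<close> the next stage is \<open>Gamma F\<close> of the
  stage at \<open>\<alpha>\<close> and equals it, so this stage is a fixed point of
  \<open>Gamma F\<close>.\<close>

lemma IND_closed: "F (IND F) \<subseteq> IND F"
proof -
  define \<alpha> where "\<alpha> = (SOME \<alpha>. \<alpha> \<in> Field omega1 \<and>
             Gamma_stage F (wo_rel.suc omega1 {\<alpha>}) = Gamma_stage F \<alpha>)"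
  have \<alpha>: "\<alpha> \<in> Field omega1" "Gamma_stage F (wo_rel.suc omega1 {\<alpha>}) = Gamma_stage F \<alpha>"
    using someI_ex[OF Gamma_closes[unfolded Bex_def]] unfolding \<alpha>_def by blast+
  \<comment> \<open>An infinite cardinal has no last element, so \<open>suc\<close> yields a proper
    successor of \<open>\<alpha>\<close>.\<close>
  have "infinite (Field omega1)"
    unfolding omega1_def cardSuc_finite[OF natLeq_Card_order] by (simp add: Field_natLeq)
  then have "AboveS omega1 {\<alpha>} \<noteq> {}"
    using infinite_Card_order_limit[OF Card_order_omega1 _ \<alpha>(1)]
    by (auto simp: AboveS_def Field_def)
  then have "\<alpha> \<in> underS omega1 (wo_rel.suc omega1 {\<alpha>})"
    using wo_rel.suc_greater[OF wo_rel_omega1, of "{\<alpha>}" \<alpha>] \<alpha>(1) by (auto simp: underS_def)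
  moreover have "Gamma_stage F \<beta> \<subseteq> Gamma_stage F \<alpha>"
    if "\<beta> \<in> underS omega1 (wo_rel.suc omega1 {\<alpha>})" for \<beta>
    using Gamma_stage_mono[OF that, of F] \<alpha>(2) by simp
  ultimately have
    "(\<Union>\<beta>\<in>underS omega1 (wo_rel.suc omega1 {\<alpha>}). Gamma_stage F \<beta>) = Gamma_stage F \<alpha>"
    by blast
  then have "Gamma_stage F \<alpha> = Gamma F (Gamma_stage F \<alpha>)"
    using Gamma_stage_eq[of F "wo_rel.suc omega1 {\<alpha>}"] \<alpha>(2) by simp
  then show ?thesis
    unfolding IND_def \<alpha>_def[symmetric] by (auto simp: Gamma_def)
qed

text \<open>Transfinite induction: from a subset of \<open>R\<close> each stage adds only elements
  of \<open>R\<close>. In the application \<open>R\<close> consists of the guesses that are really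
  false.\<close>

lemma IND_subset:
  assumes "\<And>A. A \<subseteq> R \<Longrightarrow> F A \<subseteq> R"
  shows "IND F \<subseteq> R"
proof -
  have "Gamma_stage F \<alpha> \<subseteq> R" for \<alpha>
  proof (induction \<alpha> rule: wo_rel.well_order_induct[OF wo_rel_omega1])
    case (1 \<alpha>)
    then have "(\<Union>\<beta>\<in>underS omega1 \<alpha>. Gamma_stage F \<beta>) \<subseteq> R"
      by (auto simp: underS_def)
    then show ?case
      using assms by (subst Gamma_stage_eq) (simp add: Gamma_def)
  qed
  then show ?thesis by (simp add: IND_def)
qed

section \<open>Correctness\<close>

lemma lg_eqI:
  assumes "2 ^ k \<le> p" "p < 2 ^ Suc k"
  shows "lg p = k"
proof -
  have lg: "p < 2 ^ Suc (lg p)"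
    unfolding lg_def by (rule mu[where P = "\<lambda>k. p < 2 ^ Suc k"]) (rule assms(2))
  have "lg p \<le> k"
    unfolding lg_def mu_def using assms(2) by (intro Least_le) blast
  moreover have "(2::nat) ^ k < 2 ^ Suc (lg p)" using assms(1) lg by linarith
  then have "k < Suc (lg p)" by (rule power_less_imp_less_exp[rotated]) simp
  ultimately show ?thesis by simp
qed

lemma lg:
  assumes "1 \<le> p"
  shows "2 ^ lg p \<le> p" "p < 2 ^ Suc (lg p)"
proof -
  obtain k where "2 ^ k \<le> p" "p < 2 ^ (k + 1)"
    using ex_power_ivl1[of 2 p] assms by auto
  then show "2 ^ lg p \<le> p" "p < 2 ^ Suc (lg p)" using lg_eqI[of k p] by auto
qed

definition lo :: "nat \<Rightarrow> real" where
  "lo p = real p / 2 ^ lg p"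

definition hi :: "nat \<Rightarrow> real" where
  "hi p = (real p + 1) / 2 ^ lg p"

lemma hi_eq: "hi p = lo p + 1 / 2 ^ lg p"
  by (simp add: hi_def lo_def add_divide_distrib)

text \<open>The number \<open>p * 2 ^ i + r\<close> arises from \<open>p\<close> by appending
  \<open>i\<close> binary digits.\<close>

lemma lg_shift:
  assumes "1 \<le> p" "r < 2 ^ i"
  shows "lg (p * 2 ^ i + r) = lg p + i"
proof (rule lg_eqI)
  have "2 ^ lg p * 2 ^ i \<le> p * 2 ^ i"
    using lg(1)[OF assms(1)] by simp
  then show "2 ^ (lg p + i) \<le> p * 2 ^ i + r"
    unfolding power_add by (rule trans_le_add1)
  have "p * 2 ^ i + r < (p + 1) * 2 ^ i"
    using assms(2) by (simp add: algebra_simps)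
  also have "\<dots> \<le> 2 ^ Suc (lg p) * 2 ^ i"
    using lg(2)[OF assms(1)] by (intro mult_le_mono1) simp
  finally show "p * 2 ^ i + r < 2 ^ Suc (lg p + i)"
    by (simp add: power_add)
qed

text \<open>The bounds on \<open>r\<close> exclude the first and the last of the
  \<open>2 ^ i\<close> pieces of the interval, whence strictness at both ends; they also force
  \<open>i\<close> to be positive.\<close>

lemma subnodeD:
  assumes "1 \<le> p" "subnode p q"
  shows "lg p < lg q" "lo p < lo q" "hi q < hi p" "1 \<le> q"
proof -
  from assms(2) obtain i r where q: "q = p * 2 ^ i + r" "0 < r" "Suc r < 2 ^ i"
    unfolding subnode_def by blast
  have i: "i \<noteq> 0" using q(3) by (intro notI) simp
  have l: "lg q = lg p + i" unfolding q(1) by (rule lg_shift) (use assms(1) q(3) in auto)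
  show "lg p < lg q" using l i by simp
  show "1 \<le> q" using q(2) by (simp add: q(1))
  have "real p * 2 ^ i < real q" using q(2) by (simp add: q(1))
  then show "lo p < lo q"
    unfolding lo_def l power_add by (simp add: field_simps)
  have "real q + 1 < (real p + 1) * 2 ^ i"
    using q(3) of_nat_less_iff[where 'a = real, of "Suc r" "2 ^ i"]
    by (simp add: q(1) algebra_simps)
  from divide_strict_right_mono[OF this, of "2 ^ lg p * 2 ^ i"] show "hi q < hi p"
    unfolding hi_def l power_add by simp
qed

text \<open>By density \<open>U\<close> meets the interval of \<open>p\<close>, in an open set; a
  sufficiently short dyadic interval around a point of that set fits inside with its
  closure.\<close>

lemma ex_subnode:
  assumes "1 \<le> p" "open U" "dense_reals U"
  shows "\<exists>q. subnode p q \<and> {lo q<..<hi q} \<subseteq> U"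
proof -
  have "lo p < hi p" by (simp add: hi_eq)
  then obtain y where y: "y \<in> U" "y \<in> {lo p<..<hi p}"
    using assms(3) unfolding dense_reals_def by blast
  have "open (U \<inter> {lo p<..<hi p})" using assms(2) by auto
  then obtain e where e: "e > 0" "ball y e \<subseteq> U \<inter> {lo p<..<hi p}"
    using y open_contains_ball by (metis IntI)
  obtain i where i: "(1/2::real) ^ i < e"
    using real_arch_pow_inv[OF e(1), of "1/2"] by auto
  define k where "k = lg p + i"
  have ke: "1 / 2 ^ k < e"
  proof -
    have "(1/2::real) ^ k \<le> (1/2) ^ i" unfolding k_def by (intro power_decreasing) auto
    then show ?thesis using i by (simp add: power_divide)
  qed
  \<comment> \<open>The interval of level \<open>k\<close> containing \<open>y\<close>; as
    \<open>y\<close> is not negative, \<open>nat\<close> truncates nothing.\<close>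
  define q where "q = nat \<lfloor>y * 2 ^ k\<rfloor>"
  have "0 \<le> lo p" by (simp add: lo_def)
  then have "0 \<le> y * 2 ^ k" using y(2) by simp
  then have q: "real q \<le> y * 2 ^ k" "y * 2 ^ k < real q + 1"
    unfolding q_def by (simp_all add: floor_le_iff)
  have q1: "real q / 2 ^ k \<le> y" using q(1) by (simp add: field_simps)
  have q2: "y < (real q + 1) / 2 ^ k" using q(2) by (simp add: field_simps)
  have q3: "(real q + 1) / 2 ^ k = real q / 2 ^ k + 1 / 2 ^ k" by (simp add: field_simps)
  \<comment> \<open>The closed interval is taken because \<open>subnode\<close> requires the
    endpoints to be inside \<open>p\<close> as well.\<close>
  have sub: "{real q / 2 ^ k..(real q + 1) / 2 ^ k} \<subseteq> U \<inter> {lo p<..<hi p}"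
  proof -
    have "{real q / 2 ^ k..(real q + 1) / 2 ^ k} \<subseteq> ball y e"
      using q1 q2 q3 ke by (auto simp: dist_real_def)
    then show ?thesis using e(2) by blast
  qed
  moreover have "real q / 2 ^ k \<in> {real q / 2 ^ k..(real q + 1) / 2 ^ k}"
    "(real q + 1) / 2 ^ k \<in> {real q / 2 ^ k..(real q + 1) / 2 ^ k}"
    by (simp_all add: divide_right_mono)
  ultimately have "real q / 2 ^ k \<in> {lo p<..<hi p}" "(real q + 1) / 2 ^ k \<in> {lo p<..<hi p}"
    by blast+
  then have "lo p < real q / 2 ^ k" "(real q + 1) / 2 ^ k < hi p"
    by simp_all
  then have "lo p * 2 ^ k < real q" "real q + 1 < hi p * 2 ^ k"
    by (simp_all only: pos_less_divide_eq pos_divide_less_eq zero_less_power zero_less_numeral)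
  then have "real p * 2 ^ i < real q" "real q + 1 < (real p + 1) * 2 ^ i"
    by (simp_all add: lo_def hi_def k_def power_add)
  then have "real (p * 2 ^ i) < real q" "real (q + 1) < real ((p + 1) * 2 ^ i)"
    by (simp_all add: algebra_simps)
  then have r: "p * 2 ^ i < q" "q + 1 < (p + 1) * 2 ^ i"
    unfolding of_nat_less_iff by simp_all
  define r where "r = q - p * 2 ^ i"
  have qr: "q = p * 2 ^ i + r" "0 < r" "Suc r < 2 ^ i" using r by (auto simp: r_def)
  have "lg q = k" unfolding qr(1) k_def by (rule lg_shift) (use assms(1) qr(3) in auto)
  with sub have "{lo q<..<hi q} \<subseteq> U"
    unfolding lo_def hi_def by (auto simp: subset_eq)
  moreover have "subnode p q" using qr unfolding subnode_def by blast
  ultimately show ?thesis by blast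
qed

section \<open>Codes of rationals and positivity of reals\<close>

lemma rat_code:
  "nat_to_rat_surj (prod_encode (2 * a, 2 * b)) = of_nat a / of_nat b"
  "nat_to_rat_surj (prod_encode (2 * a + 1, 2 * b + 1)) = (of_nat a + 1) / (of_nat b + 1)"
proof -
  have e: "int_decode (2 * a) = int a" for a
    using int_encode_inverse[of "int a"] by (simp add: int_encode_def sum_encode_def)
  have o: "int_decode (2 * a + 1) = - int a - 1" for a
    using int_encode_inverse[of "- int a - 1"] by (simp add: int_encode_def sum_encode_def)
  show "nat_to_rat_surj (prod_encode (2 * a, 2 * b)) = of_nat a / of_nat b"
    by (simp add: nat_to_rat_surj_def e Fract_of_int_quotient)
  have "(- of_nat a - 1) / (- of_nat b - 1) = (of_nat a + 1) / (of_nat b + 1 :: rat)"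
    using minus_divide_divide[of "of_nat a + 1" "of_nat b + 1 :: rat"] by simp
  then show "nat_to_rat_surj (prod_encode (2 * a + 1, 2 * b + 1)) = (of_nat a + 1) / (of_nat b + 1)"
    unfolding nat_to_rat_surj_def prod_encode_inverse Let_def prod.case o
    by (simp add: Fract_of_int_quotient)
qed

lemma pos_rat_iff: "pos_rat v k \<longleftrightarrow> 1 / 2 ^ k < nat_to_rat_surj v"
proof
  assume "pos_rat v k"
  then consider a b where "v = prod_encode (2 * a, 2 * b)" "0 < b" "b < a * 2 ^ k" |
    a b where "v = prod_encode (2 * a + 1, 2 * b + 1)" "b + 1 < (a + 1) * 2 ^ k"
    unfolding pos_rat_def by blast
  then show "1 / 2 ^ k < nat_to_rat_surj v"
  proof cases
    case 1
    have "(of_nat b :: rat) < of_nat (a * 2 ^ k)" using 1(3) unfolding of_nat_less_iff .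
    then show ?thesis unfolding 1(1) rat_code using 1(2) by (simp add: field_simps)
  next
    case 2
    have "(of_nat (b + 1) :: rat) < of_nat ((a + 1) * 2 ^ k)" using 2(2) unfolding of_nat_less_iff .
    then show ?thesis unfolding 2(1) rat_code by (simp add: field_simps)
  qed
next
  assume *: "1 / 2 ^ k < nat_to_rat_surj v"
  then have pos: "0 < nat_to_rat_surj v" by (rule order.strict_trans[rotated]) simp
  obtain c d where v: "v = prod_encode (int_encode c, int_encode d)"
    by (metis int_decode_inverse prod.exhaust prod_decode_inverse)
  have r: "nat_to_rat_surj v = of_int c / of_int d"
    by (simp add: v nat_to_rat_surj_def Fract_of_int_quotient)
  \<comment> \<open>A zero denominator yields the rational 0, so two sign patterns remain, one for
    each disjunct of \<open>pos_rat\<close>.\<close>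
  from pos have "c > 0 \<and> d > 0 \<or> c < 0 \<and> d < 0"
    by (simp add: r zero_less_divide_iff)
  then show "pos_rat v k"
  proof
    assume cd: "c > 0 \<and> d > 0"
    have v': "v = prod_encode (2 * nat c, 2 * nat d)"
      using cd by (simp add: v int_encode_def sum_encode_def)
    have "(of_nat (nat d) :: rat) < of_nat (nat c * 2 ^ k)"
      using * cd unfolding v' rat_code by (simp add: field_simps)
    then have "nat d < nat c * 2 ^ k" unfolding of_nat_less_iff .
    then show ?thesis unfolding pos_rat_def using v' cd
      by (intro exI[of _ "nat c"] exI[of _ "nat d"]) auto
  next
    assume cd: "c < 0 \<and> d < 0"
    define a where "a = nat (- c - 1)"
    define b where "b = nat (- d - 1)"
    have v': "v = prod_encode (2 * a + 1, 2 * b + 1)"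
      using cd by (simp add: v int_encode_def sum_encode_def a_def b_def)
    have "(of_nat (b + 1) :: rat) < of_nat ((a + 1) * 2 ^ k)"
      using * unfolding v' rat_code by (simp add: field_simps)
    then have "b + 1 < (a + 1) * 2 ^ k" unfolding of_nat_less_iff .
    then show ?thesis unfolding pos_rat_def using v' by blast
  qed
qed

text \<open>The \<open>k\<close>-th approximation is within \<open>1 / 2 ^ k\<close> of
  \<open>y\<close>, so exceeding this bound forces \<open>y > 0\<close>. Conversely, any
  \<open>k\<close> with \<open>1 / 2 ^ k < y / 2\<close> is a witness.\<close>

lemma codes_real_pos_iff:
  assumes "codes_real v y"
  shows "0 < y \<longleftrightarrow> (\<exists>k. pos_rat (v k) k)"
proof -
  define q where "q n = real_of_rat (nat_to_rat_surj (v n))" for n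
  have lim: "q \<longlonglongrightarrow> y"
    using assms unfolding codes_real_def q_def by blast
  have cauchy: "\<bar>q n - q (n + i)\<bar> \<le> 1 / 2 ^ n" for n i
  proof -
    have "\<bar>nat_to_rat_surj (v n) - nat_to_rat_surj (v (n + i))\<bar> < 1 / 2 ^ n"
      using assms unfolding codes_real_def by blast
    then have "real_of_rat \<bar>nat_to_rat_surj (v n) - nat_to_rat_surj (v (n + i))\<bar>
        < of_rat (1 / 2 ^ n)"
      unfolding of_rat_less .
    then show ?thesis by (simp add: q_def of_rat_diff of_rat_divide of_rat_power flip: abs_of_rat)
  qed
  have dist: "\<bar>q n - y\<bar> \<le> 1 / 2 ^ n" for n
  proof (rule LIMSEQ_le_const2)
    show "(\<lambda>i. \<bar>q n - q (n + i)\<bar>) \<longlonglongrightarrow> \<bar>q n - y\<bar>"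
      using LIMSEQ_ignore_initial_segment[OF lim, of n]
      by (intro tendsto_intros) (simp add: add.commute)
  qed (use cauchy in blast)
  have pos: "pos_rat (v k) k \<longleftrightarrow> 1 / 2 ^ k < q k" for k
  proof -
    have "real_of_rat (1 / 2 ^ k) < q k \<longleftrightarrow> 1 / 2 ^ k < nat_to_rat_surj (v k)"
      unfolding q_def of_rat_less ..
    then show ?thesis by (simp add: pos_rat_iff of_rat_divide of_rat_power)
  qed
  show ?thesis
  proof
    assume "0 < y"
    then obtain k where "(1/2) ^ k < y / 2" using real_arch_pow_inv[of "y / 2" "1/2"] by auto
    then have "1 / 2 ^ k < y / 2" by (simp add: power_divide)
    then have "1 / 2 ^ k < q k" using dist[of k] by (auto simp: abs_le_iff)
    then show "\<exists>k. pos_rat (v k) k" using pos by blast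
  next
    assume "\<exists>k. pos_rat (v k) k"
    then obtain k where "1 / 2 ^ k < q k" using pos by blast
    then show "0 < y" using dist[of k] by (auto simp: abs_le_iff)
  qed
qed

text \<open>Under the hypothesis \<open>mu\<close> never takes its default value, so the nodes form
  nested intervals of length at most \<open>1 / 2 ^ n\<close>, whose left endpoints are the
  approximations in \<open>point A\<close>.\<close>

lemma codes_real_point:
  assumes "\<And>n p. 1 \<le> p \<Longrightarrow> \<exists>q. subnode p q \<and> A (prod_encode (n, q)) = 0"
  obtains x where "codes_real (point A) x" "\<And>n. x \<in> {lo (node A n)<..<hi (node A n)}"
    "\<And>n. A (prod_encode (n, node A (Suc n))) = 0"
proof -
  let ?p = "node A"
  have Suc: "?p (Suc n) = mu (\<lambda>q. subnode (?p n) q \<and> A (prod_encode (n, q)) = 0)" for n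
    by (simp add: node_def)
  have step: "subnode (?p n) (?p (Suc n)) \<and> A (prod_encode (n, ?p (Suc n))) = 0"
    if "1 \<le> ?p n" for n
    using assms[OF that, of n] mu[of "\<lambda>q. subnode (?p n) q \<and> A (prod_encode (n, q)) = 0"]
    unfolding Suc by blast
  have ge: "1 \<le> ?p n" for n
  proof (induction n)
    case (Suc n)
    then show ?case using step subnodeD(4) by blast
  qed (simp add: node_def)
  have ins: "subnode (?p n) (?p (Suc n))" for n using step ge by blast
  note D = subnodeD[OF ge ins]
  have lg: "n \<le> lg (?p n)" for n
  proof (induction n)
    case (Suc n)
    then show ?case using D(1)[of n] by simp
  qed simp
  have "strict_mono (\<lambda>n. lo (?p n))" "strict_mono (\<lambda>n. - hi (?p n))"
    using D(2,3) by (auto simp: strict_mono_Suc_iff)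
  then have mono: "lo (?p m) \<le> lo (?p n)" "hi (?p n) \<le> hi (?p m)" if "m \<le> n" for m n
    using that monoD[OF strict_mono_mono, of "\<lambda>n. lo (?p n)" m n]
      monoD[OF strict_mono_mono, of "\<lambda>n. - hi (?p n)" m n] by auto
  have lh: "lo p < hi p" for p by (simp add: hi_eq)
  have cross: "lo (?p n) \<le> hi (?p m)" for n m
    using mono(1)[of n "max m n"] mono(2)[of m "max m n"] lh[of "?p (max m n)"] by simp
  obtain x where x: "(\<lambda>n. lo (?p n)) \<longlonglongrightarrow> x"
  proof (rule incseq_convergent)
    show "incseq (\<lambda>n. lo (?p n))" using mono(1) by (simp add: incseq_def)
    show "\<forall>n. lo (?p n) \<le> hi (?p 0)" using cross by simp
  qed
  \<comment> \<open>The limit lies in the closure of the next interval, which is contained in the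
    open interval of \<open>?p n\<close>.\<close>
  have x_in: "x \<in> {lo (?p n)<..<hi (?p n)}" for n
  proof -
    have "lo (?p (Suc n)) \<le> x"
      using x mono(1) by (intro incseq_le) (auto simp: incseq_def)
    moreover have "x \<le> hi (?p (Suc n))"
      using x cross by (intro LIMSEQ_le_const2[OF x]) blast
    ultimately show ?thesis using D(2,3)[of n] by simp
  qed
  have q: "nat_to_rat_surj (point A n) = of_nat (?p n) / 2 ^ lg (?p n)" for n
    by (simp add: point_def rat_code)
  have q': "real_of_rat (nat_to_rat_surj (point A n)) = lo (?p n)" for n
    by (simp add: q lo_def of_rat_divide of_rat_power)
  have "\<bar>nat_to_rat_surj (point A n) - nat_to_rat_surj (point A (n + i))\<bar> < 1 / 2 ^ n" for n i
  proof -
    \<comment> \<open>The strict inequality here supplies the strict bound demanded by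
      \<open>codes_real\<close>.\<close>
    have "lo (?p n) \<le> lo (?p (n + i))" "lo (?p (n + i)) < hi (?p n)"
      using mono[of n "n + i"] lh[of "?p (n + i)"] by auto
    moreover have "1 / 2 ^ lg (?p n) \<le> (1 / 2 ^ n :: real)"
      using lg[of n] by (intro divide_left_mono power_increasing) auto
    ultimately have "\<bar>lo (?p n) - lo (?p (n + i))\<bar> < 1 / 2 ^ n" by (simp add: hi_eq)
    then have "real_of_rat \<bar>nat_to_rat_surj (point A n) - nat_to_rat_surj (point A (n + i))\<bar>
        < of_rat (1 / 2 ^ n)"
      by (simp add: of_rat_diff q' of_rat_divide of_rat_power flip: abs_of_rat)
    then show ?thesis unfolding of_rat_less .
  qed
  then have "codes_real (point A) x"
    unfolding codes_real_def q' using x by blast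
  then show thesis using that x_in step ge by blast
qed

theorem theorem6p5:
  shows "\<exists>\<xi> :: (nat \<Rightarrow> baire \<Rightarrow> baire) \<Rightarrow> baire.
    kleene_computable_in \<xi> [E2] [IND3] \<and>
    (\<forall>(Y :: nat \<Rightarrow> real \<Rightarrow> real) (\<Phi> :: nat \<Rightarrow> baire \<Rightarrow> baire).
       (\<forall>n. codes_real_fun (\<Phi> n) (Y n)) \<and>
       (\<forall>n. open (pos_set (Y n)) \<and> dense_reals (pos_set (Y n))) \<longrightarrow>
       (\<exists>x. codes_real (\<xi> \<Phi>) x \<and> x \<in> (\<Inter>n. pos_set (Y n))))"
proof (intro exI[of _ baire_point] conjI allI impI)
  show "kleene_computable_in baire_point [E2] [IND3]"
    by (rule kleene_computable_baire_point)
next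
  fix Y :: "nat \<Rightarrow> real \<Rightarrow> real" and \<Phi> :: "nat \<Rightarrow> baire \<Rightarrow> baire"
  assume asm: "(\<forall>n. codes_real_fun (\<Phi> n) (Y n)) \<and>
       (\<forall>n. open (pos_set (Y n)) \<and> dense_reals (pos_set (Y n)))"
  \<comment> \<open>The false guesses. As long as only these are refuted, every interval keeps an
    unrefuted subnode, so the construction yields a point.\<close>
  define R where "R = {prod_encode (n, q) | n q. \<not> {lo q<..<hi q} \<subseteq> pos_set (Y n)}"
  define F where "F A = {m. refutations \<Phi> (char_fun A) m > 0}" for A
  have F: "F A = {prod_encode (n, node (char_fun A) (Suc n)) | n.
      \<not> (\<exists>k. pos_rat (\<Phi> n (point (char_fun A)) k) k)}" for A
    by (auto simp: F_def refutations_def)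
  \<comment> \<open>The outcome of the positivity test depends only on the real, whichever code
    \<open>v\<close> of it is used, since \<open>\<Phi> n\<close> represents
    \<open>Y n\<close>.\<close>
  have pos: "(\<exists>k. pos_rat (\<Phi> n v k) k) \<longleftrightarrow> x \<in> pos_set (Y n)" if "codes_real v x" for n v x
    using codes_real_pos_iff[of "\<Phi> n v" "Y n x"] asm that
    by (auto simp: codes_real_fun_def pos_set_def)
  have ex: "\<exists>q. subnode p q \<and> char_fun A (prod_encode (n, q)) = 0"
    if A: "A \<subseteq> R" and p: "1 \<le> p" for A n p
  proof -
    obtain q where q: "subnode p q" "{lo q<..<hi q} \<subseteq> pos_set (Y n)"
      using ex_subnode[OF p] asm by blast
    then have "prod_encode (n, q) \<notin> R"
      by (auto simp: R_def)
    then have "prod_encode (n, q) \<notin> A" using A by blast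
    then show ?thesis using q(1) by (auto simp: char_fun_def)
  qed
  \<comment> \<open>The point lies in the interval of each refuted guess and outside the
    corresponding set, so the guess is indeed false.\<close>
  have "F A \<subseteq> R" if A: "A \<subseteq> R" for A
  proof -
    obtain x where x: "codes_real (point (char_fun A)) x"
      "\<And>n. x \<in> {lo (node (char_fun A) n)<..<hi (node (char_fun A) n)}"
      using codes_real_point[OF ex[OF A]] by metis
    show ?thesis
      unfolding F pos[OF x(1)] R_def using x(2) by blast
  qed
  then have sub: "IND F \<subseteq> R" by (rule IND_subset)
  obtain x where x: "codes_real (point (char_fun (IND F))) x"
    and new: "\<And>n. char_fun (IND F) (prod_encode (n, node (char_fun (IND F)) (Suc n))) = 0"
    using codes_real_point[OF ex[OF sub]] by metis
  have "x \<in> pos_set (Y n)" for n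
  proof (rule ccontr)
    assume "x \<notin> pos_set (Y n)"
    then have "prod_encode (n, node (char_fun (IND F)) (Suc n)) \<in> F (IND F)"
      unfolding F pos[OF x] by blast
    then have "prod_encode (n, node (char_fun (IND F)) (Suc n)) \<in> IND F"
      using IND_closed by blast
    then show False using new[of n] by (simp add: char_fun_def)
  qed
  moreover have "baire_point \<Phi> = point (char_fun (IND F))"
    by (simp add: baire_point_def IND1_def F_def[abs_def])
  ultimately show "\<exists>x. codes_real (baire_point \<Phi>) x \<and> x \<in> (\<Inter>n. pos_set (Y n))"
    using x by auto
qed

end
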